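(* For any natural numbers $m,n : \mathbb{N}$, if $m =_t n : \mathbb{N}$ is a computational path, then $t$ rewrites (via the rules of $LND_{EQ}$-$TRS$) to the reflexive path $\rho$.
   Context: $\mathbb{N}$ is the inductive type generated by $0:\mathbb{N}$ and $succ:\mathbb{N}\to\mathbb{N}$; its computational paths are all generated from the reflexive path $0 =_{\rho} 0$ by applications of the axioms and rules of the $\lambda\beta\eta$-equality theory. Computational paths: for terms $a,b$ of a type $A$, a computational path $a =_s b : A$ is a syntactic term recording a finite composition of rewrites, each an application of a rule of the equality theory: $(\rho)$ $M =_\rho M$; $(\sigma)$ symmetry $N =_{\sigma(r)} M$ from $M =_r N$; $(\tau)$ transitivity $M =_{\tau(r,s)} P$ from $M=_r N$, $N=_s P$; $(\beta)$, $(\eta)$; $(\mu)$ congruence of application in the argument ($f(x) =_{\mu_f(p)} f(y)$ from $x=_p y$); $(\nu)$ congruence in the function position; $(\xi)$ congruence under $\lambda$. Path terms are rewritten by the system $LND_{EQ}$-$TRS$, which includes: $\sigma(\rho)\rhd\rho$; $\tau(\rho,\rho)\rhd\rho$ (instances of $\tau(r,\rho)\rhd r$); $\mu_f(\rho_x)\rhd\rho_{f(x)}$; $\nu(\rho_x)\rhd\rho_{f(x)}$; $\xi(\rho)\rhd\rho$.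
   Formalization: The path t is assumed to be built from reflexive paths by σ, τ, μ, ν, ξ only, without β or η steps; with β allowed the claim fails, e.g. (λx.x)0 =_β 0 has distinct end points. Terms are simply typed over ℕ with 0 and succ. *)

theory Defs
  imports Main
begin

datatype ty = TNat | Fun ty ty

text \<open>Terms are in de Bruijn notation. The type of natural numbers is generated by the constant
  \<open>Zero\<close> and the function constant \<open>Succ\<close>.\<close>

datatype tm = Var nat | Zero | Succ | App tm tm | Lam ty tm

primrec lift :: "tm \<Rightarrow> nat \<Rightarrow> tm" where
  "lift (Var i) k = (if i < k then Var i else Var (Suc i))"
| "lift Zero k = Zero"
| "lift Succ k = Succ"
| "lift (App M N) k = App (lift M k) (lift N k)"
| "lift (Lam A M) k = Lam A (lift M (Suc k))"

text \<open>\<open>subst M N k\<close> replaces the variable \<open>k\<close> of \<open>M\<close> by \<open>N\<close> and closes the gap left by \<open>k\<close>.\<close>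

primrec subst :: "tm \<Rightarrow> tm \<Rightarrow> nat \<Rightarrow> tm" where
  "subst (Var i) N k = (if k < i then Var (i - 1) else if i = k then N else Var i)"
| "subst Zero N k = Zero"
| "subst Succ N k = Succ"
| "subst (App M M') N k = App (subst M N k) (subst M' N k)"
| "subst (Lam A M) N k = Lam A (subst M (lift N 0) (Suc k))"

inductive has_type :: "ty list \<Rightarrow> tm \<Rightarrow> ty \<Rightarrow> bool" where
  var: "i < length \<Gamma> \<Longrightarrow> has_type \<Gamma> (Var i) (\<Gamma> ! i)"
| zero: "has_type \<Gamma> Zero TNat"
| succ: "has_type \<Gamma> Succ (Fun TNat TNat)"
| app: "has_type \<Gamma> M (Fun A B) \<Longrightarrow> has_type \<Gamma> N A \<Longrightarrow> has_type \<Gamma> (App M N) B"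
| lam: "has_type (A # \<Gamma>) M B \<Longrightarrow> has_type \<Gamma> (Lam A M) (Fun A B)"

text \<open>Path terms. \<open>Rho a\<close> is \<open>\<rho>\<close> at \<open>a\<close>; \<open>Mu f p\<close> is \<open>\<mu>\<close> of \<open>p\<close> with subscript \<open>f\<close>;
  \<open>Nu p x\<close> applies both sides of \<open>p\<close> to \<open>x\<close>; \<open>Xi A p\<close> binds a variable of type \<open>A\<close> in \<open>p\<close>.\<close>

datatype path =
    Rho tm
  | Sig path
  | Tau path path
  | Beta ty tm tm
  | Eta ty tm
  | Mu tm path
  | Nu path tm
  | Xi ty path

text \<open>\<open>cpath \<Gamma> a s b A\<close> is the judgement that \<open>s\<close> is a computational path from \<open>a\<close> to \<open>b\<close>
  in type \<open>A\<close>, in the theory of \<open>\<lambda>\<beta>\<eta>\<close>-equality.\<close>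

inductive cpath :: "ty list \<Rightarrow> tm \<Rightarrow> path \<Rightarrow> tm \<Rightarrow> ty \<Rightarrow> bool" where
  rho: "has_type \<Gamma> M A \<Longrightarrow> cpath \<Gamma> M (Rho M) M A"
| sigma: "cpath \<Gamma> M r N A \<Longrightarrow> cpath \<Gamma> N (Sig r) M A"
| tau: "cpath \<Gamma> M r N A \<Longrightarrow> cpath \<Gamma> N s P A \<Longrightarrow> cpath \<Gamma> M (Tau r s) P A"
| beta: "has_type (A # \<Gamma>) M B \<Longrightarrow> has_type \<Gamma> N A \<Longrightarrow>
    cpath \<Gamma> (App (Lam A M) N) (Beta A M N) (subst M N 0) B"
| eta: "has_type \<Gamma> M (Fun A B) \<Longrightarrow>
    cpath \<Gamma> (Lam A (App (lift M 0) (Var 0))) (Eta A M) M (Fun A B)"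
| mu: "has_type \<Gamma> f (Fun A B) \<Longrightarrow> cpath \<Gamma> x p y A \<Longrightarrow>
    cpath \<Gamma> (App f x) (Mu f p) (App f y) B"
| nu: "cpath \<Gamma> f p g (Fun A B) \<Longrightarrow> has_type \<Gamma> x A \<Longrightarrow>
    cpath \<Gamma> (App f x) (Nu p x) (App g x) B"
| xi: "cpath (A # \<Gamma>) M p N B \<Longrightarrow> cpath \<Gamma> (Lam A M) (Xi A p) (Lam A N) (Fun A B)"

text \<open>The part of \<open>LND\<^bsub>EQ\<^esub>-TRS\<close> that contracts applications of the rules to reflexivity, closed
  under path contexts. A reduction in this part is a reduction in the full system.\<close>

inductive rw :: "path \<Rightarrow> path \<Rightarrow> bool" (infix "\<rhd>" 50) where
  "Sig (Rho a) \<rhd> Rho a"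
| "Tau r (Rho a) \<rhd> r"
| "Mu f (Rho x) \<rhd> Rho (App f x)"
| "Nu (Rho f) x \<rhd> Rho (App f x)"
| "Xi A (Rho M) \<rhd> Rho (Lam A M)"
| "r \<rhd> r' \<Longrightarrow> Sig r \<rhd> Sig r'"
| "r \<rhd> r' \<Longrightarrow> Tau r s \<rhd> Tau r' s"
| "s \<rhd> s' \<Longrightarrow> Tau r s \<rhd> Tau r s'"
| "p \<rhd> p' \<Longrightarrow> Mu f p \<rhd> Mu f p'"
| "p \<rhd> p' \<Longrightarrow> Nu p x \<rhd> Nu p' x"
| "p \<rhd> p' \<Longrightarrow> Xi A p \<rhd> Xi A p'"

text \<open>\<open>refl_generated t\<close> renders that the paths of the natural numbers are generated from
  \<open>0 =\<^sub>\<rho> 0\<close> by the rules of the equality theory. Reflexivity is admitted at every term, as \<open>\<nu>\<close>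
  and \<open>\<xi>\<close> act on paths between functions and between open terms. The axioms \<open>\<beta>\<close> and \<open>\<eta>\<close> have no
  path premise: they do not produce paths from given ones but would be generators next to
  reflexivity, and then there are loops at \<open>0\<close> that do not contract, see \<open>beta_loop\<close>.\<close>

inductive refl_generated :: "path \<Rightarrow> bool" where
  "refl_generated (Rho M)"
| "refl_generated r \<Longrightarrow> refl_generated (Sig r)"
| "refl_generated r \<Longrightarrow> refl_generated s \<Longrightarrow> refl_generated (Tau r s)"
| "refl_generated p \<Longrightarrow> refl_generated (Mu f p)"
| "refl_generated p \<Longrightarrow> refl_generated (Nu p x)"
| "refl_generated p \<Longrightarrow> refl_generated (Xi A p)"

inductive_simps rw_inverts: "Rho a \<rhd> q" "Sig r \<rhd> q" "Tau r s \<rhd> q" "Beta A M N \<rhd> q"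
  "Mu f p \<rhd> q"

lemma beta_loop:
  defines "I \<equiv> Lam TNat (Var 0)"
  defines "b \<equiv> Beta TNat (Var 0) Zero"
  defines "c \<equiv> Beta TNat (Var 0) (App I Zero)"
  defines "l \<equiv> Tau (Sig b) (Tau (Sig c) (Tau (Mu I b) b))"
  shows "cpath [] Zero l Zero TNat" and "\<not> rw\<^sup>*\<^sup>* l (Rho Zero)"
proof -
  have v: "has_type [TNat] (Var 0) TNat"
    using has_type.var[of 0 "[TNat]"] by simp
  have I: "has_type [] I (Fun TNat TNat)"
    unfolding I_def by (rule has_type.lam[OF v])
  have IZ: "has_type [] (App I Zero) TNat"
    by (rule has_type.app[OF I has_type.zero])
  have b: "cpath [] (App I Zero) b Zero TNat"
    using cpath.beta[OF v has_type.zero] by (simp add: I_def b_def)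
  have c: "cpath [] (App I (App I Zero)) c (App I Zero) TNat"
    using cpath.beta[OF v IZ] by (simp add: I_def c_def)
  show "cpath [] Zero l Zero TNat"
    unfolding l_def by (intro cpath.tau[OF cpath.sigma[OF b]] cpath.tau[OF cpath.sigma[OF c]]
        cpath.tau[OF cpath.mu[OF I b] b])
  have "\<not> l \<rhd> r" for r
    unfolding l_def b_def c_def by (simp add: rw_inverts)
  then show "\<not> rw\<^sup>*\<^sup>* l (Rho Zero)"
    by (auto simp: l_def elim: converse_rtranclpE)
qed

end

theory Submission
  imports Defs
begin

text \<open>With \<open>f\<close> a path constructor, this carries the contraction of a premise
  through a congruence rule and appends the final step at the root.\<close>

lemma rtranclp_map_step:
  assumes "r\<^sup>*\<^sup>* x y" and step: "\<And>a b. r a b \<Longrightarrow> r (f a) (f b)" and "r (f y) z"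
  shows "r\<^sup>*\<^sup>* (f x) z"
proof -
  have "r\<^sup>*\<^sup>* (f x) (f y)"
    using assms(1) by induction (auto dest: step)
  then show ?thesis
    using assms(3) by (rule rtranclp.rtrancl_into_rtrancl)
qed

text \<open>No rule generates \<open>Beta\<close> or \<open>Eta\<close>, so their eliminations are
  contradictions; this closes both axiom cases of the induction below.\<close>

inductive_cases refl_generatedE [elim!]:
  "refl_generated (Sig r)" "refl_generated (Tau r s)" "refl_generated (Beta A M N)"
  "refl_generated (Eta A M)" "refl_generated (Mu f p)" "refl_generated (Nu p x)"
  "refl_generated (Xi A p)"

\<comment> \<open>The end points must be shown equal along with the contraction: after the premises of
  \<open>\<mu>\<close>, \<open>\<nu>\<close>, \<open>\<xi>\<close> or \<open>\<tau>\<close> have contracted, the subscripts of \<open>\<rho>\<close> match the rules.\<close>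
lemma refl_generated_contracts:
  assumes "cpath \<Gamma> a t b A" and "refl_generated t"
  shows "a = b \<and> rw\<^sup>*\<^sup>* t (Rho a)"
  using assms
proof (induction rule: cpath.induct)
  case (sigma \<Gamma> M r N A)
  \<comment> \<open>\<open>Sig r\<close> starts at \<open>N\<close> but contracts to
    \<open>Rho M\<close>; the equality of end points reconciles the two.\<close>
  then have "M = N" and "rw\<^sup>*\<^sup>* r (Rho M)" by auto
  then show ?case
    using rtranclp_map_step[of rw r "Rho M" Sig] by (auto intro: rw.intros)
next
  case (tau \<Gamma> M r N A s P)
  then have eq: "M = N" "N = P" and r: "rw\<^sup>*\<^sup>* r (Rho M)" and s: "rw\<^sup>*\<^sup>* s (Rho N)" by auto
  \<comment> \<open>Only \<open>s\<close> is contracted under \<open>Tau\<close>; the root rule then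
    drops it, and \<open>r\<close> contracts by itself.\<close>
  have "rw\<^sup>*\<^sup>* (Tau r s) r"
    using s by (rule rtranclp_map_step[where f = "Tau r"]) (auto intro: rw.intros)
  with r eq show ?case by auto
next
  case (mu \<Gamma> f A B x p y)
  then have "x = y" and "rw\<^sup>*\<^sup>* p (Rho x)" by auto
  then show ?case
    using rtranclp_map_step[of rw p "Rho x" "Mu f"] by (auto intro: rw.intros)
next
  case (nu \<Gamma> f p g A B x)
  then have "f = g" and "rw\<^sup>*\<^sup>* p (Rho f)" by auto
  then show ?case
    using rtranclp_map_step[of rw p "Rho f" "\<lambda>p. Nu p x"] by (auto intro: rw.intros)
next
  case (xi A \<Gamma> M p N B)
  then have "M = N" and "rw\<^sup>*\<^sup>* p (Rho M)" by auto
  then show ?case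
    using rtranclp_map_step[of rw p "Rho M" "Xi A"] by (auto intro: rw.intros)
qed auto

theorem theorem2:
  fixes \<Gamma> :: "ty list" and m n :: tm and t :: path
  assumes "has_type \<Gamma> m TNat" and "has_type \<Gamma> n TNat"
    and "cpath \<Gamma> m t n TNat" and "refl_generated t"
  shows "rw\<^sup>*\<^sup>* t (Rho m)"
  \<comment> \<open>The induction needs all types and contexts, as \<open>Nu\<close> has a premise
    at function type and \<open>Xi\<close> one in a longer context; only here is the type
    \<open>TNat\<close>.\<close>
  using refl_generated_contracts[OF assms(3,4)] by (rule conjunct2)

end
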